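(* Let $F:\mathbb{R}^n\to\mathbb{R}^n$ be continuously differentiable with Jacobian $J$. Suppose there is $L>0$ such that $\|J(x)-J(y)\|\le L\|x-y\|$ for all $x,y\in\mathbb{R}^n$, and suppose $J$ satisfies the one-sided Lipschitz condition: there are a constant vector $c\in\mathbb{R}^n$ with $c^TF(x)=0$ for all $x\in\mathbb{R}^n$ and a number $\nu>0$ such that, for all $x\in\mathbb{R}^n$, $$y^TJ(x)y\le-\nu\|y\|^2\quad\text{for all } y\in S_c=\{y\in\mathbb{R}^n: c^Ty=0\}.$$ Let $\{x_k\}$ be a sequence generated by the CNMTr algorithm (described in the context), and suppose that a subsequence $\{x_{k_i}\}$ converges to $x^*$. Then the whole sequence $\{x_k\}$ converges superlinearly to $x^*$.
   Context: $\|\cdot\|$ is the Euclidean norm on vectors and its induced norm on matrices; $J(x)=\partial F(x)/\partial x$; $I$ is the identity matrix. The sequence $\{x_k\}$ converges superlinearly to $x^*$ if $x_k\to x^*$ and $\lim_{k\to\infty}\|x_{k+1}-x^*\|/\|x_k-x^*\|=0$. CNMTr algorithm. Constants: $\eta_a=10^{-6}$, $\eta_1=0.25$, $\eta_2=0.75$, $\gamma_1=2$, $\gamma_2=0.5$, and a small positive constant $c_\epsilon$. Given a starting point $x_0\in\mathbb{R}^n$ and $\Delta t_0=10^{-2}$, for $k=0,1,2,\ldots$: 1. If $k=0$ or the previous trial step was accepted, let $s_k^P$ be the solution of $(\mu_k I-J(x_k))s_k^P=F(x_k)$, where $\mu_k=c_\epsilon$ if $\Delta t_k\le 1/c_\epsilon$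 and $\mu_k=1/\Delta t_k$ otherwise. If the previous trial step was rejected, $s_k^P=s_{k-1}^P$ is reused. 2. Set $s_k=\frac{\Delta t_k}{1+\Delta t_k}s_k^P$; the trial point is $x_k+s_k$. 3. If $\|F(x_k)\|<\|F(x_k)+J(x_k)s_k\|$ set $\rho_k=-1$; otherwise set $\rho_k=\dfrac{\|F(x_k)\|-\|F(x_k+s_k)\|}{\|F(x_k)\|-\|F(x_k)+J(x_k)s_k\|}$. 4. Set $\Delta t_{k+1}=\gamma_1\Delta t_k$ if $|1-\rho_k|\le\eta_1$; $\Delta t_{k+1}=\Delta t_k$ if $\eta_1<|1-\rho_k|<\eta_2$; $\Delta t_{k+1}=\gamma_2\Delta t_k$ otherwise. 5. If $\rho_k\ge\eta_a$, accept: $x_{k+1}=x_k+s_k$. Otherwise reject: $x_{k+1}=x_k$. The iteration stops only if $F(x_k)=0$; asymptotic statements concern the case in which an infinite sequence is generated. *)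

theory Defs
  imports "HOL-Analysis.Analysis"
begin

text \<open>
  The matrix norm is the one induced by the Euclidean vector norm, i.e. \<^const>\<open>onorm\<close> of the
  matrix-vector map.  The constant \<^const>\<open>norm\<close> on \<^typ>\<open>real ^ 'n ^ 'n\<close> would be the Frobenius norm.
\<close>

definition induced_norm :: "real ^ 'n ^ 'n \<Rightarrow> real" where
  "induced_norm A = onorm (\<lambda>v. A *v v)"

definition continuously_differentiable_with_jacobian ::
    "(real ^ 'n \<Rightarrow> real ^ 'n) \<Rightarrow> (real ^ 'n \<Rightarrow> real ^ 'n ^ 'n) \<Rightarrow> bool" where
  "continuously_differentiable_with_jacobian F J \<longleftrightarrow>
     (\<forall>x. (F has_derivative (\<lambda>h. J x *v h)) (at x)) \<and> continuous_on UNIV J"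

definition one_sided_lipschitz ::
    "(real ^ 'n \<Rightarrow> real ^ 'n) \<Rightarrow> (real ^ 'n \<Rightarrow> real ^ 'n ^ 'n) \<Rightarrow> bool" where
  "one_sided_lipschitz F J \<longleftrightarrow>
     (\<exists>c. (\<forall>x. c \<bullet> F x = 0) \<and>
        (\<exists>\<nu>>0. \<forall>x. \<forall>y\<in>{y. c \<bullet> y = 0}. y \<bullet> (J x *v y) \<le> - \<nu> * (norm y)\<^sup>2))"

definition converges_superlinearly ::
    "(nat \<Rightarrow> 'a::real_normed_vector) \<Rightarrow> 'a \<Rightarrow> bool" where
  "converges_superlinearly x xs \<longleftrightarrow>
     x \<longlonglongrightarrow> xs \<and> (\<lambda>k. norm (x (Suc k) - xs) / norm (x k - xs)) \<longlonglongrightarrow> 0"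

definition \<eta>\<^sub>a :: real where "\<eta>\<^sub>a = 1 / 10 ^ 6"
definition \<eta>\<^sub>1 :: real where "\<eta>\<^sub>1 = 1 / 4"
definition \<eta>\<^sub>2 :: real where "\<eta>\<^sub>2 = 3 / 4"
definition \<gamma>\<^sub>1 :: real where "\<gamma>\<^sub>1 = 2"
definition \<gamma>\<^sub>2 :: real where "\<gamma>\<^sub>2 = 1 / 2"

definition cnmtr_mu :: "real \<Rightarrow> real \<Rightarrow> real" where
  "cnmtr_mu c\<^sub>\<epsilon> \<Delta>t = (if \<Delta>t \<le> 1 / c\<^sub>\<epsilon> then c\<^sub>\<epsilon> else 1 / \<Delta>t)"

definition cnmtr_rho ::
    "(real ^ 'n \<Rightarrow> real ^ 'n) \<Rightarrow> (real ^ 'n \<Rightarrow> real ^ 'n ^ 'n) \<Rightarrow> real ^ 'n \<Rightarrow> real ^ 'n \<Rightarrow> real" where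
  "cnmtr_rho F J x s =
     (if norm (F x) < norm (F x + J x *v s) then - 1
      else (norm (F x) - norm (F (x + s))) / (norm (F x) - norm (F x + J x *v s)))"

definition cnmtr_next_dt :: "real \<Rightarrow> real \<Rightarrow> real" where
  "cnmtr_next_dt \<Delta>t \<rho> =
     (if \<bar>1 - \<rho>\<bar> \<le> \<eta>\<^sub>1 then \<gamma>\<^sub>1 * \<Delta>t
      else if \<eta>\<^sub>1 < \<bar>1 - \<rho>\<bar> \<and> \<bar>1 - \<rho>\<bar> < \<eta>\<^sub>2 then \<Delta>t
      else \<gamma>\<^sub>2 * \<Delta>t)"

text \<open>
  The update rules at every index: \<open>sP\<close>, \<open>s\<close>, \<open>\<rho>\<close> and \<open>\<Delta>t\<close> are the sequences of
  predicted steps, trial steps, ratios and time steps.  The previous trial step was accepted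
  iff \<open>\<eta>\<^sub>a \<le> \<rho> (k - 1)\<close>.  The stopping test is not part of this
  predicate: an infinite sequence is generated iff moreover \<open>F (x k)\<close> never vanishes.
\<close>

definition cnmtr_run ::
    "(real ^ 'n \<Rightarrow> real ^ 'n) \<Rightarrow> (real ^ 'n \<Rightarrow> real ^ 'n ^ 'n) \<Rightarrow> real \<Rightarrow>
     (nat \<Rightarrow> real ^ 'n) \<Rightarrow> (nat \<Rightarrow> real) \<Rightarrow> (nat \<Rightarrow> real ^ 'n) \<Rightarrow> (nat \<Rightarrow> real ^ 'n) \<Rightarrow>
     (nat \<Rightarrow> real) \<Rightarrow> bool" where
  "cnmtr_run F J c\<^sub>\<epsilon> x \<Delta>t sP s \<rho> \<longleftrightarrow>
     \<Delta>t 0 = 1 / 10 ^ 2 \<and>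
     (\<forall>k.
       (if k = 0 \<or> \<rho> (k - 1) \<ge> \<eta>\<^sub>a
        then (cnmtr_mu c\<^sub>\<epsilon> (\<Delta>t k) *\<^sub>R mat 1 - J (x k)) *v sP k = F (x k)
        else sP k = sP (k - 1)) \<and>
       s k = (\<Delta>t k / (1 + \<Delta>t k)) *\<^sub>R sP k \<and>
       \<rho> k = cnmtr_rho F J (x k) (s k) \<and>
       \<Delta>t (Suc k) = cnmtr_next_dt (\<Delta>t k) (\<rho> k) \<and>
       x (Suc k) = (if \<rho> k \<ge> \<eta>\<^sub>a then x k + s k else x k))"

definition cnmtr_sequence ::
    "(real ^ 'n \<Rightarrow> real ^ 'n) \<Rightarrow> (real ^ 'n \<Rightarrow> real ^ 'n ^ 'n) \<Rightarrow> real \<Rightarrow>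
     (nat \<Rightarrow> real ^ 'n) \<Rightarrow> bool" where
  "cnmtr_sequence F J c\<^sub>\<epsilon> x \<longleftrightarrow> (\<exists>\<Delta>t sP s \<rho>. cnmtr_run F J c\<^sub>\<epsilon> x \<Delta>t sP s \<rho>)"

end

theory Submission
  imports Defs
begin

text \<open>
  The theorem rests on one geometric fact.  Since \<open>c \<bullet> F\<close> vanishes identically, so does
  \<open>c \<bullet> (J x *v v)\<close>; the regularised Newton equation then forces every step to be orthogonal to
  \<open>c\<close>, so the iterates never leave the hyperplane \<open>c \<bullet> (y - x 0) = 0\<close> (the whole space if
  \<open>c = 0\<close>).  On that hyperplane the one-sided Lipschitz condition has two consequences:
  \<^item> the solution \<open>v\<close> of \<open>(\<mu> I - J x) v = F x\<close> satisfies \<open>(\<mu> + \<nu>) \<parallel>v\<parallel> \<le> \<parallel>F x\<parallel>\<close>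
    (\<open>regularised_step_bound\<close>), hence the linear model predicts a decrease of \<open>\<parallel>F\<parallel>\<close> proportional
    to \<open>\<parallel>F x\<parallel>\<close> (\<open>damped_model_bound\<close>);
  \<^item> \<open>\<nu> \<parallel>y - z\<parallel> \<le> \<parallel>F y - F z\<parallel>\<close> (\<open>residual_error_bound\<close>), so residuals control distances to a zero.

  The linearisation error is quadratic in the step, so \<open>\<bar>1 - \<rho>\<bar>\<close> is at most a constant times
  \<open>\<alpha> \<parallel>F\<parallel>\<close>, with \<open>\<alpha> = \<Delta>t / (1 + \<Delta>t)\<close> the damping factor (\<open>ratio_near_one\<close>).
  This estimate is used twice.  With \<open>\<parallel>F\<parallel>\<close> merely bounded, it shows that small time steps are always
  doubled, so \<open>\<Delta>t\<close> is bounded below (\<open>dt_bounded_below\<close>); therefore rejection, which halves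
  \<open>\<Delta>t\<close>, cannot persist, and each accepted step contracts \<open>\<parallel>F\<parallel>\<close> by a fixed factor, so
  \<open>F (x k)\<close> tends to \<open>0\<close> (\<open>residual_tendsto_0\<close>).  With \<open>\<parallel>F\<parallel>\<close> small, it shows that eventually every
  step is accepted and \<open>\<Delta>t\<close> doubles, so \<open>\<alpha>\<close> tends to \<open>1\<close> and the regularisation \<open>\<mu>\<close> tends to
  \<open>0\<close>: the method turns into Newton's method and the contraction factor of \<open>\<parallel>F\<parallel>\<close> tends to \<open>0\<close>.
  The error bound and the Lipschitz continuity of \<open>F\<close> near the limit carry both conclusions over
  from residuals to distances.
\<close>

section \<open>Vector fields that dissipate along a hyperplane\<close>

text \<open>
  The constant \<open>c\<close> and the rate \<open>\<nu>\<close> are parameters rather than existentially bound, because the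
  iteration is analysed relative to one fixed hyperplane.
\<close>

locale tangentially_dissipative =
  fixes F :: "real ^ 'n \<Rightarrow> real ^ 'n" and J :: "real ^ 'n \<Rightarrow> real ^ 'n ^ 'n"
    and c :: "real ^ 'n" and \<nu> L :: real
  assumes deriv: "\<And>x. (F has_derivative (\<lambda>h. J x *v h)) (at x)"
    and jacobian_lipschitz: "\<And>x y. induced_norm (J x - J y) \<le> L * norm (x - y)"
    and L_pos: "L > 0"
    and tangent: "\<And>x. c \<bullet> F x = 0"
    and \<nu>_pos: "\<nu> > 0"
    and dissipative: "\<And>x y. c \<bullet> y = 0 \<Longrightarrow> y \<bullet> (J x *v y) \<le> - \<nu> * (norm y)\<^sup>2"
begin

lemma linearisation_error:
  "norm (F (x + h) - F x - J x *v h) \<le> L * (norm h)\<^sup>2"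
proof -
  have der: "((\<lambda>y. F y - J x *v y) has_derivative (\<lambda>v. (J y - J x) *v v)) (at y within cball x (norm h))"
    for y
    using has_derivative_at_withinI[OF deriv[of y], of "cball x (norm h)"]
    by (auto simp: matrix_vector_mult_diff_rdistrib
        intro!: derivative_eq_intros bounded_linear_imp_has_derivative matrix_vector_mul_bounded_linear)
  have bd: "onorm (\<lambda>v. (J y - J x) *v v) \<le> L * norm h" if "y \<in> cball x (norm h)" for y
  proof -
    have "onorm (\<lambda>v. (J y - J x) *v v) \<le> L * norm (y - x)"
      using jacobian_lipschitz[of y x] by (simp add: induced_norm_def)
    also have "\<dots> \<le> L * norm h"
      using that L_pos by (simp add: dist_norm norm_minus_commute)
    finally show ?thesis .
  qed
  have "norm ((F (x + h) - J x *v (x + h)) - (F x - J x *v x)) \<le> L * norm h * norm (x + h - x)"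
    by (rule differentiable_bound[OF convex_cball der bd]) (auto simp: dist_norm)
  then show ?thesis
    by (simp add: algebra_simps matrix_vector_right_distrib power2_eq_square)
qed

lemma jacobian_tangent: "c \<bullet> (J x *v v) = 0"
proof -
  have "((\<lambda>y. c \<bullet> F y) has_derivative (\<lambda>h. c \<bullet> (J x *v h))) (at x)"
    using deriv by (rule has_derivative_inner_right)
  moreover have "((\<lambda>y. c \<bullet> F y) has_derivative (\<lambda>h. 0)) (at x)"
    by (simp add: tangent)
  ultimately show ?thesis
    by (metis has_derivative_unique)
qed

text \<open>
  Along the segment from \<open>z\<close> to \<open>y\<close>, the component of \<open>F\<close> in the direction \<open>y - z\<close> decreases at
  rate at least \<open>\<nu> \<parallel>y - z\<parallel>\<^sup>2\<close>; the Cauchy--Schwarz inequality turns this strong monotonicity into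
  an error bound.
\<close>

lemma residual_error_bound:
  assumes "c \<bullet> (y - z) = 0"
  shows "\<nu> * norm (y - z) \<le> norm (F y - F z)"
proof (cases "y = z")
  case False
  define w where "w = y - z"
  have w: "norm w > 0" "c \<bullet> w = 0"
    using False assms by (auto simp: w_def)
  have "((\<lambda>t. w \<bullet> F (z + t *\<^sub>R w)) has_derivative
      (\<lambda>h. w \<bullet> (J (z + t *\<^sub>R w) *v (h *\<^sub>R w)))) (at t within {0..1})" for t :: real
    by (rule has_derivative_inner_right, rule has_derivative_compose[OF _ deriv])
      (auto intro!: derivative_eq_intros)
  then obtain t :: real where
    "w \<bullet> F (z + 1 *\<^sub>R w) - w \<bullet> F (z + 0 *\<^sub>R w) = w \<bullet> (J (z + t *\<^sub>R w) *v ((1 - 0) *\<^sub>R w))"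
    using mvt_simple[of 0 1 "\<lambda>t. w \<bullet> F (z + t *\<^sub>R w)"
        "\<lambda>t h. w \<bullet> (J (z + t *\<^sub>R w) *v (h *\<^sub>R w))"] by auto
  then have "w \<bullet> (F y - F z) \<le> - \<nu> * (norm w)\<^sup>2"
    using dissipative[OF w(2)] by (simp add: w_def inner_diff_right)
  then have "\<nu> * norm w * norm w \<le> norm (F y - F z) * norm w"
    using Cauchy_Schwarz_ineq2[of w "F y - F z"] by (simp add: power2_eq_square mult.commute mult.left_commute)
  then show ?thesis
    using w by (simp add: w_def)
qed simp

lemma residual_le_distance:
  assumes "F z = 0" "norm (y - z) \<le> 1"
  shows "norm (F y) \<le> (induced_norm (J z) + L) * norm (y - z)"
proof -
  have "norm (F y) \<le> norm (J z *v (y - z)) + norm (F (z + (y - z)) - F z - J z *v (y - z))"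
    using norm_triangle_ineq[of "J z *v (y - z)" "F (z + (y - z)) - F z - J z *v (y - z)"]
    by (simp add: assms)
  also have "\<dots> \<le> induced_norm (J z) * norm (y - z) + L * (norm (y - z))\<^sup>2"
    unfolding induced_norm_def
    by (intro add_mono linearisation_error onorm matrix_vector_mul_bounded_linear)
  also have "L * (norm (y - z))\<^sup>2 \<le> L * norm (y - z)"
    using L_pos assms(2) by (simp add: power2_eq_square mult_left_le)
  finally show ?thesis
    by (simp add: algebra_simps)
qed

text \<open>
  Pairing the equation with \<open>c\<close> leaves \<open>\<mu> (c \<bullet> v) = 0\<close>.  Once \<open>v\<close> is known to be tangent,
  pairing with \<open>v\<close> itself and dissipation give the length bound.
\<close>

lemma regularised_step_bound:
  assumes "\<mu> > 0" and step: "(\<mu> *\<^sub>R mat 1 - J x) *v v = F x"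
  shows "c \<bullet> v = 0" and "(\<mu> + \<nu>) * norm v \<le> norm (F x)"
proof -
  have eq: "\<mu> *\<^sub>R v - J x *v v = F x"
    using step by (simp add: matrix_vector_mult_diff_rdistrib scaleR_matrix_vector_assoc[symmetric])
  have "\<mu> * (c \<bullet> v) = 0"
    using arg_cong[OF eq, of "\<lambda>u. c \<bullet> u"]
    by (simp add: inner_diff_right jacobian_tangent tangent)
  then show cv: "c \<bullet> v = 0"
    using \<open>\<mu> > 0\<close> by simp
  have "\<mu> * (v \<bullet> v) - v \<bullet> (J x *v v) = v \<bullet> F x"
    using arg_cong[OF eq, of "\<lambda>u. v \<bullet> u"] by (simp add: inner_diff_right)
  then have "(\<mu> + \<nu>) * (norm v)\<^sup>2 \<le> v \<bullet> F x"
    using dissipative[OF cv, of x] by (simp add: power2_norm_eq_inner algebra_simps)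
  also have "\<dots> \<le> norm v * norm (F x)"
    by (rule norm_cauchy_schwarz)
  finally have "norm v * ((\<mu> + \<nu>) * norm v) \<le> norm v * norm (F x)"
    by (simp add: power2_eq_square mult.left_commute)
  then show "(\<mu> + \<nu>) * norm v \<le> norm (F x)"
    by (cases "v = 0") auto
qed

text \<open>
  Substituting the equation, the model value is the combination
  \<open>(1 - \<alpha>) F x + \<alpha> \<mu> v\<close>, and \<open>\<mu> v\<close> is shorter than \<open>F x\<close> by the factor \<open>\<mu> / (\<mu> + \<nu>)\<close>.
\<close>

lemma damped_model_bound:
  assumes "\<mu> > 0" and step: "(\<mu> *\<^sub>R mat 1 - J x) *v v = F x" and \<alpha>: "0 \<le> \<alpha>" "\<alpha> \<le> 1"
  shows "norm (F x + J x *v (\<alpha> *\<^sub>R v)) \<le> (1 - \<alpha> * (\<nu> / (\<mu> + \<nu>))) * norm (F x)"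
proof -
  have eq: "J x *v v = \<mu> *\<^sub>R v - F x"
    using step by (auto simp: matrix_vector_mult_diff_rdistrib scaleR_matrix_vector_assoc[symmetric] algebra_simps)
  have "F x + J x *v (\<alpha> *\<^sub>R v) = (1 - \<alpha>) *\<^sub>R F x + (\<alpha> * \<mu>) *\<^sub>R v"
    by (simp add: matrix_vector_mult_scaleR eq algebra_simps)
  then have "norm (F x + J x *v (\<alpha> *\<^sub>R v)) \<le> (1 - \<alpha>) * norm (F x) + \<alpha> * \<mu> * norm v"
    using norm_triangle_ineq[of "(1 - \<alpha>) *\<^sub>R F x" "(\<alpha> * \<mu>) *\<^sub>R v"] \<alpha> \<open>\<mu> > 0\<close> by simp
  also have "norm v \<le> norm (F x) / (\<mu> + \<nu>)"
    using regularised_step_bound(2)[OF assms(1) step] \<open>\<mu> > 0\<close> \<nu>_pos by (simp add: field_simps)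
  then have "\<alpha> * \<mu> * norm v \<le> \<alpha> * \<mu> * (norm (F x) / (\<mu> + \<nu>))"
    using \<alpha> \<open>\<mu> > 0\<close> by (intro mult_left_mono) auto
  also have "(1 - \<alpha>) * norm (F x) + \<alpha> * \<mu> * (norm (F x) / (\<mu> + \<nu>))
      = (1 - \<alpha> * (\<nu> / (\<mu> + \<nu>))) * norm (F x)"
    using \<open>\<mu> > 0\<close> \<nu>_pos by (simp add: field_simps)
  finally show ?thesis by simp
qed

end

section \<open>Global convergence of the residuals\<close>

locale cnmtr_iteration = tangentially_dissipative F J c \<nu> L
  for F :: "real ^ 'n \<Rightarrow> real ^ 'n" and J c \<nu> L +
  fixes c\<^sub>\<epsilon> :: real and x :: "nat \<Rightarrow> real ^ 'n" and \<Delta>t :: "nat \<Rightarrow> real"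
    and sP s :: "nat \<Rightarrow> real ^ 'n" and \<rho> :: "nat \<Rightarrow> real"
  assumes c\<^sub>\<epsilon>_pos: "c\<^sub>\<epsilon> > 0"
    and run: "cnmtr_run F J c\<^sub>\<epsilon> x \<Delta>t sP s \<rho>"
    and residual_nonzero: "\<And>k. F (x k) \<noteq> 0"
begin

definition \<alpha> :: "nat \<Rightarrow> real" where "\<alpha> k = \<Delta>t k / (1 + \<Delta>t k)"

text \<open>The guaranteed relative decrease of the undamped model, at the largest regularisation \<open>c\<^sub>\<epsilon>\<close>.\<close>

definition \<kappa> :: real where "\<kappa> = \<nu> / (c\<^sub>\<epsilon> + \<nu>)"

lemma
  shows dt_0: "\<Delta>t 0 = 1 / 10 ^ 2"
    and predicted_fresh: "k = 0 \<or> \<rho> (k - 1) \<ge> \<eta>\<^sub>a \<Longrightarrow>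
      (cnmtr_mu c\<^sub>\<epsilon> (\<Delta>t k) *\<^sub>R mat 1 - J (x k)) *v sP k = F (x k)"
    and predicted_reused: "\<not> \<rho> k \<ge> \<eta>\<^sub>a \<Longrightarrow> sP (Suc k) = sP k"
    and trial_step: "s k = \<alpha> k *\<^sub>R sP k"
    and ratio: "\<rho> k = cnmtr_rho F J (x k) (s k)"
    and dt_Suc: "\<Delta>t (Suc k) = cnmtr_next_dt (\<Delta>t k) (\<rho> k)"
    and accepted: "\<rho> k \<ge> \<eta>\<^sub>a \<Longrightarrow> x (Suc k) = x k + s k"
    and rejected: "\<not> \<rho> k \<ge> \<eta>\<^sub>a \<Longrightarrow> x (Suc k) = x k"
  using run unfolding cnmtr_run_def \<alpha>_def
  by (auto dest!: spec[of _ k] dest: spec[of _ "Suc k"] split: if_splits)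

lemma dt_pos: "\<Delta>t k > 0"
  by (induction k) (auto simp: dt_0 dt_Suc cnmtr_next_dt_def \<gamma>\<^sub>1_def \<gamma>\<^sub>2_def)

lemma dt_doubles: "\<bar>1 - \<rho> k\<bar> \<le> 1 / 4 \<Longrightarrow> \<Delta>t (Suc k) = 2 * \<Delta>t k"
  by (simp add: dt_Suc cnmtr_next_dt_def \<eta>\<^sub>1_def \<gamma>\<^sub>1_def)

lemma dt_halves: "\<not> \<rho> k \<ge> \<eta>\<^sub>a \<Longrightarrow> \<Delta>t (Suc k) = \<Delta>t k / 2"
  by (auto simp: dt_Suc cnmtr_next_dt_def \<eta>\<^sub>a_def \<eta>\<^sub>1_def \<eta>\<^sub>2_def \<gamma>\<^sub>2_def)

lemma dt_at_least_halves: "\<Delta>t (Suc k) \<ge> \<Delta>t k / 2"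
  using dt_pos[of k] by (auto simp: dt_Suc cnmtr_next_dt_def \<gamma>\<^sub>1_def \<gamma>\<^sub>2_def)

lemma ratio_near_one_accepts: "\<bar>1 - \<rho> k\<bar> \<le> 1 / 4 \<Longrightarrow> \<rho> k \<ge> \<eta>\<^sub>a"
  by (simp add: \<eta>\<^sub>a_def abs_if split: if_splits)

lemma \<alpha>_bounds: "0 < \<alpha> k" "\<alpha> k < 1" "\<alpha> k \<le> \<Delta>t k"
  using dt_pos[of k] by (auto simp: \<alpha>_def divide_simps algebra_simps)

lemma \<kappa>_bounds: "0 < \<kappa>" "\<kappa> < 1"
  using \<nu>_pos c\<^sub>\<epsilon>_pos by (auto simp: \<kappa>_def)

lemma cnmtr_mu_bounds: "t > 0 \<Longrightarrow> 0 < cnmtr_mu c\<^sub>\<epsilon> t" "t > 0 \<Longrightarrow> cnmtr_mu c\<^sub>\<epsilon> t \<le> c\<^sub>\<epsilon>"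
  using c\<^sub>\<epsilon>_pos by (auto simp: cnmtr_mu_def field_simps)

text \<open>
  A reused step still solves a regularised equation at the current point, because rejection leaves
  the point unchanged; only the regularisation parameter is the one of an earlier time step.
\<close>

lemma predicted_step:
  "\<exists>\<mu>. 0 < \<mu> \<and> \<mu> \<le> c\<^sub>\<epsilon> \<and> (\<mu> *\<^sub>R mat 1 - J (x k)) *v sP k = F (x k)"
proof (induction k)
  case 0
  show ?case
    using predicted_fresh[of 0] cnmtr_mu_bounds[OF dt_pos[of 0]] by blast
next
  case (Suc k)
  show ?case
  proof (cases "\<rho> k \<ge> \<eta>\<^sub>a")
    case True
    then show ?thesis
      using predicted_fresh[of "Suc k"] cnmtr_mu_bounds[OF dt_pos[of "Suc k"]] by auto
  next
    case False
    then show ?thesis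
      using Suc by (simp add: predicted_reused rejected)
  qed
qed

lemma model_bound: "norm (F (x k) + J (x k) *v s k) \<le> (1 - \<alpha> k * \<kappa>) * norm (F (x k))"
proof -
  obtain \<mu> where \<mu>: "0 < \<mu>" "\<mu> \<le> c\<^sub>\<epsilon>" "(\<mu> *\<^sub>R mat 1 - J (x k)) *v sP k = F (x k)"
    using predicted_step by blast
  have "norm (F (x k) + J (x k) *v s k) \<le> (1 - \<alpha> k * (\<nu> / (\<mu> + \<nu>))) * norm (F (x k))"
    unfolding trial_step using \<alpha>_bounds[of k] by (intro damped_model_bound \<mu>) auto
  moreover have "\<kappa> \<le> \<nu> / (\<mu> + \<nu>)"
    using \<mu> \<nu>_pos unfolding \<kappa>_def by (intro divide_left_mono) (auto intro!: mult_pos_pos add_pos_pos)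
  then have "(1 - \<alpha> k * (\<nu> / (\<mu> + \<nu>))) * norm (F (x k)) \<le> (1 - \<alpha> k * \<kappa>) * norm (F (x k))"
    using \<alpha>_bounds[of k] by (intro mult_right_mono diff_left_mono mult_left_mono) auto
  ultimately show ?thesis by simp
qed

lemma step_tangent: "c \<bullet> s k = 0"
proof -
  obtain \<mu> where "0 < \<mu>" "(\<mu> *\<^sub>R mat 1 - J (x k)) *v sP k = F (x k)"
    using predicted_step by blast
  then show ?thesis
    by (simp add: trial_step regularised_step_bound(1))
qed

lemma step_size: "norm (s k) \<le> \<alpha> k * norm (F (x k)) / \<nu>"
proof -
  obtain \<mu> where \<mu>: "0 < \<mu>" "(\<mu> *\<^sub>R mat 1 - J (x k)) *v sP k = F (x k)"
    using predicted_step by blast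
  have "\<nu> * norm (sP k) \<le> (\<mu> + \<nu>) * norm (sP k)"
    using \<mu> by (simp add: mult_right_mono)
  also have "\<dots> \<le> norm (F (x k))"
    by (rule regularised_step_bound(2)[OF \<mu>])
  finally have "norm (sP k) \<le> norm (F (x k)) / \<nu>"
    using \<nu>_pos by (simp add: field_simps)
  then show ?thesis
    using \<alpha>_bounds[of k] mult_left_mono[of "norm (sP k)" "norm (F (x k)) / \<nu>" "\<alpha> k"]
    by (simp add: trial_step)
qed

lemma iterates_in_hyperplane: "c \<bullet> x k = c \<bullet> x 0"
proof (induction k)
  case (Suc k)
  then show ?case
    by (cases "\<rho> k \<ge> \<eta>\<^sub>a") (auto simp: accepted rejected inner_add_right step_tangent)
qed simp

lemma model_error:
  "norm (F (x k + s k) - (F (x k) + J (x k) *v s k)) \<le> L * (\<alpha> k * norm (F (x k)) / \<nu>)\<^sup>2"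
proof -
  have "norm (F (x k + s k) - (F (x k) + J (x k) *v s k)) \<le> L * (norm (s k))\<^sup>2"
    using linearisation_error[of "x k" "s k"] by (simp add: algebra_simps)
  also have "\<dots> \<le> L * (\<alpha> k * norm (F (x k)) / \<nu>)\<^sup>2"
    using L_pos step_size by (intro mult_left_mono power_mono) auto
  finally show ?thesis .
qed

text \<open>
  By the model bound the predicted decrease is positive, so the exceptional value \<open>- 1\<close> of
  \<open>\<rho>\<close> and division by zero never occur.
\<close>

lemma
  shows predicted_decrease: "norm (F (x k)) - norm (F (x k) + J (x k) *v s k) \<ge> \<alpha> k * \<kappa> * norm (F (x k))"
    and predicted_decrease_pos: "\<alpha> k * \<kappa> * norm (F (x k)) > 0"
    and ratio_eq: "\<rho> k = (norm (F (x k)) - norm (F (x k + s k))) /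
      (norm (F (x k)) - norm (F (x k) + J (x k) *v s k))"
proof -
  show 1: "norm (F (x k)) - norm (F (x k) + J (x k) *v s k) \<ge> \<alpha> k * \<kappa> * norm (F (x k))"
    using model_bound[of k] by (simp add: algebra_simps)
  show 2: "\<alpha> k * \<kappa> * norm (F (x k)) > 0"
    using \<alpha>_bounds[of k] \<kappa>_bounds residual_nonzero[of k] by simp
  show "\<rho> k = (norm (F (x k)) - norm (F (x k + s k))) /
      (norm (F (x k)) - norm (F (x k) + J (x k) *v s k))"
    using 1 2 by (auto simp: ratio cnmtr_rho_def)
qed

text \<open>
  The model error is quadratic in \<open>\<alpha> \<parallel>F\<parallel>\<close> while the predicted decrease is linear in it, so one
  factor survives in the quotient.
\<close>

lemma ratio_near_one: "\<bar>1 - \<rho> k\<bar> \<le> L / (\<nu>\<^sup>2 * \<kappa>) * (\<alpha> k * norm (F (x k)))"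
proof -
  define p where "p = norm (F (x k)) - norm (F (x k) + J (x k) *v s k)"
  have p: "p \<ge> \<alpha> k * \<kappa> * norm (F (x k))" "p > 0"
    using predicted_decrease[of k] predicted_decrease_pos[of k] by (auto simp: p_def)
  have "1 - \<rho> k = (norm (F (x k + s k)) - norm (F (x k) + J (x k) *v s k)) / p"
    using p(2) by (simp add: ratio_eq p_def[symmetric] field_simps) (simp add: p_def)
  then have "\<bar>1 - \<rho> k\<bar> = \<bar>norm (F (x k + s k)) - norm (F (x k) + J (x k) *v s k)\<bar> / p"
    using p by simp
  also have "\<dots> \<le> L * (\<alpha> k * norm (F (x k)) / \<nu>)\<^sup>2 / p"
    using p by (intro divide_right_mono order_trans[OF norm_triangle_ineq3 model_error]) auto
  also have "\<dots> \<le> L * (\<alpha> k * norm (F (x k)) / \<nu>)\<^sup>2 / (\<alpha> k * \<kappa> * norm (F (x k)))"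
    using p predicted_decrease_pos[of k] L_pos by (intro divide_left_mono) auto
  also have "\<dots> = L / (\<nu>\<^sup>2 * \<kappa>) * (\<alpha> k * norm (F (x k)))"
    using \<alpha>_bounds[of k] \<kappa>_bounds residual_nonzero[of k] \<nu>_pos
    by (simp add: power2_eq_square field_simps)
  finally show ?thesis .
qed

lemma residual_contracts_if_accepted:
  assumes "\<rho> k \<ge> \<eta>\<^sub>a"
  shows "norm (F (x (Suc k))) \<le> (1 - \<eta>\<^sub>a * (\<alpha> k * \<kappa>)) * norm (F (x k))"
proof -
  define p where "p = norm (F (x k)) - norm (F (x k) + J (x k) *v s k)"
  have p: "p \<ge> \<alpha> k * \<kappa> * norm (F (x k))" "p > 0"
    using predicted_decrease[of k] predicted_decrease_pos[of k] by (auto simp: p_def)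
  have "\<eta>\<^sub>a * (\<alpha> k * \<kappa> * norm (F (x k))) \<le> \<eta>\<^sub>a * p"
    using p by (intro mult_left_mono) (auto simp: \<eta>\<^sub>a_def)
  also have "\<dots> \<le> \<rho> k * p"
    using assms p by (intro mult_right_mono) auto
  also have "\<dots> = norm (F (x k)) - norm (F (x (Suc k)))"
    using p by (simp add: ratio_eq p_def[symmetric] accepted[OF assms])
  finally show ?thesis
    by (simp add: algebra_simps)
qed

lemma decseq_residual: "decseq (\<lambda>k. norm (F (x k)))"
proof (rule decseq_SucI)
  fix k
  show "norm (F (x (Suc k))) \<le> norm (F (x k))"
  proof (cases "\<rho> k \<ge> \<eta>\<^sub>a")
    case True
    have "\<eta>\<^sub>a * (\<alpha> k * \<kappa>) * norm (F (x k)) \<ge> 0"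
      using \<alpha>_bounds[of k] \<kappa>_bounds by (simp add: \<eta>\<^sub>a_def)
    then have "(1 - \<eta>\<^sub>a * (\<alpha> k * \<kappa>)) * norm (F (x k)) \<le> norm (F (x k))"
      by (simp add: algebra_simps)
    then show ?thesis
      using residual_contracts_if_accepted[OF True] by linarith
  qed (simp add: rejected)
qed

text \<open>
  Below the threshold \<open>\<delta>\<close> the ratio is so close to \<open>1\<close> that the time step doubles; above it, one
  update loses at most a factor of two.
\<close>

lemma dt_bounded_below: "\<exists>\<tau>>0. \<forall>k. \<Delta>t k \<ge> \<tau>"
proof -
  define C where "C = L / (\<nu>\<^sup>2 * \<kappa>) * norm (F (x 0))"
  have C: "C > 0"
    using L_pos \<nu>_pos \<kappa>_bounds residual_nonzero[of 0] by (simp add: C_def)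
  define \<delta> where "\<delta> = 1 / (4 * C)"
  define \<tau> where "\<tau> = min (1 / 10 ^ 2) (\<delta> / 2)"
  have "\<Delta>t k \<ge> \<tau>" for k
  proof (induction k)
    case 0
    show ?case by (simp add: \<tau>_def dt_0)
  next
    case (Suc k)
    show ?case
    proof (cases "\<Delta>t k \<le> \<delta>")
      case True
      have "norm (F (x k)) \<le> norm (F (x 0))"
        using decseqD[OF decseq_residual, of 0 k] by simp
      then have "\<alpha> k * norm (F (x k)) \<le> \<delta> * norm (F (x 0))"
        using True \<alpha>_bounds[of k] by (intro mult_mono) auto
      then have "L / (\<nu>\<^sup>2 * \<kappa>) * (\<alpha> k * norm (F (x k))) \<le> L / (\<nu>\<^sup>2 * \<kappa>) * (\<delta> * norm (F (x 0)))"
        using L_pos \<kappa>_bounds by (intro mult_left_mono) auto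
      also have "\<dots> = C * \<delta>"
        by (simp add: C_def)
      also have "\<dots> = 1 / 4"
        using C by (simp add: \<delta>_def)
      finally have "\<Delta>t (Suc k) = 2 * \<Delta>t k"
        using ratio_near_one[of k] by (intro dt_doubles) linarith
      then show ?thesis
        using Suc dt_pos[of k] by simp
    next
      case False
      then show ?thesis
        using dt_at_least_halves[of k] by (simp add: \<tau>_def)
    qed
  qed
  moreover have "\<tau> > 0"
    using C by (simp add: \<tau>_def \<delta>_def)
  ultimately show ?thesis by blast
qed

lemma infinitely_many_accepted: "\<exists>k\<ge>N. \<rho> k \<ge> \<eta>\<^sub>a"
proof (rule ccontr)
  assume "\<not> ?thesis"
  then have "\<Delta>t (Suc k) = \<Delta>t k / 2" if "k \<ge> N" for k
    using dt_halves that by blast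
  then have "\<Delta>t (N + j) = \<Delta>t N * (1 / 2) ^ j" for j
    by (induction j) auto
  moreover have "(\<lambda>j. \<Delta>t N * (1 / 2) ^ j) \<longlonglongrightarrow> \<Delta>t N * 0"
    by (intro tendsto_mult tendsto_const LIMSEQ_power_zero) simp
  ultimately have "(\<lambda>j. \<Delta>t (N + j)) \<longlonglongrightarrow> \<Delta>t N * 0"
    by simp
  moreover obtain \<tau> where "\<tau> > 0" "\<And>k. \<Delta>t k \<ge> \<tau>"
    using dt_bounded_below by blast
  ultimately show False
    using LIMSEQ_le_const[of "\<lambda>j. \<Delta>t (N + j)" "\<Delta>t N * 0" \<tau>] by auto
qed

text \<open>
  The residual norms decrease to a limit \<open>l\<close>.  Were \<open>l > 0\<close>, the fixed contraction factor of an
  accepted step taken late enough would push the residual below \<open>l\<close>.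
\<close>

lemma residual_tendsto_0: "(\<lambda>k. norm (F (x k))) \<longlonglongrightarrow> 0"
proof -
  obtain \<tau> where \<tau>: "\<tau> > 0" "\<And>k. \<Delta>t k \<ge> \<tau>"
    using dt_bounded_below by blast
  \<comment> \<open>\<open>\<alpha>\<close> increases with \<open>\<Delta>t\<close>, so the smallest time step has the weakest contraction.\<close>
  define q where "q = 1 - \<eta>\<^sub>a * (\<tau> / (1 + \<tau>) * \<kappa>)"
  have "\<eta>\<^sub>a * (\<tau> / (1 + \<tau>) * \<kappa>) > 0"
    using \<tau>(1) \<kappa>_bounds by (intro mult_pos_pos divide_pos_pos) (auto simp: \<eta>\<^sub>a_def)
  then have "q < 1"
    by (simp add: q_def)
  have contract: "norm (F (x (Suc k))) \<le> q * norm (F (x k))" if "\<rho> k \<ge> \<eta>\<^sub>a" for k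
  proof -
    have "\<tau> / (1 + \<tau>) \<le> \<alpha> k"
      using \<tau>(1) \<tau>(2)[of k] by (simp add: \<alpha>_def divide_simps algebra_simps)
    then have "1 - \<eta>\<^sub>a * (\<alpha> k * \<kappa>) \<le> q"
      unfolding q_def using \<kappa>_bounds
      by (intro diff_left_mono mult_left_mono mult_right_mono) (auto simp: \<eta>\<^sub>a_def)
    then have "(1 - \<eta>\<^sub>a * (\<alpha> k * \<kappa>)) * norm (F (x k)) \<le> q * norm (F (x k))"
      by (rule mult_right_mono) simp
    with residual_contracts_if_accepted[OF that] show ?thesis by linarith
  qed
  obtain l where lim: "(\<lambda>k. norm (F (x k))) \<longlonglongrightarrow> l" and l: "\<And>k. l \<le> norm (F (x k))"
    using decseq_convergent[OF decseq_residual, of 0] by auto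
  have "l \<ge> 0"
    by (rule LIMSEQ_le_const[OF lim]) auto
  moreover have "\<not> l > 0"
  proof
    assume "l > 0"
    have "(\<lambda>k. q * norm (F (x k))) \<longlonglongrightarrow> q * l"
      by (intro tendsto_intros lim)
    moreover have "q * l < l"
      using \<open>q < 1\<close> \<open>l > 0\<close> by simp
    ultimately have "eventually (\<lambda>k. q * norm (F (x k)) < l) sequentially"
      by (rule order_tendstoD(2))
    then obtain N where "\<And>k. k \<ge> N \<Longrightarrow> q * norm (F (x k)) < l"
      by (auto simp: eventually_sequentially)
    then show False
      using infinitely_many_accepted[of N] contract l by (meson not_less order_trans)
  qed
  ultimately show ?thesis
    using lim by (metis less_eq_real_def)
qed

section \<open>Transition to Newton's method and superlinear rate\<close>

lemma eventually_ratio_near_one: "eventually (\<lambda>k. \<bar>1 - \<rho> k\<bar> \<le> 1 / 4) sequentially"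
proof -
  have "(\<lambda>k. L / (\<nu>\<^sup>2 * \<kappa>) * norm (F (x k))) \<longlonglongrightarrow> L / (\<nu>\<^sup>2 * \<kappa>) * 0"
    by (intro tendsto_intros residual_tendsto_0)
  then have "eventually (\<lambda>k. L / (\<nu>\<^sup>2 * \<kappa>) * norm (F (x k)) < 1 / 4) sequentially"
    by (rule order_tendstoD(2)) simp
  then show ?thesis
  proof eventually_elim
    case (elim k)
    have "\<alpha> k * norm (F (x k)) \<le> norm (F (x k))"
      using \<alpha>_bounds[of k] by (simp add: mult_left_le_one_le)
    then have "L / (\<nu>\<^sup>2 * \<kappa>) * (\<alpha> k * norm (F (x k))) \<le> L / (\<nu>\<^sup>2 * \<kappa>) * norm (F (x k))"
      using L_pos \<kappa>_bounds by (intro mult_left_mono) auto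
    then show ?case
      using ratio_near_one[of k] elim by linarith
  qed
qed

lemma dt_at_top: "filterlim \<Delta>t at_top sequentially"
proof -
  obtain N where "\<And>k. k \<ge> N \<Longrightarrow> \<bar>1 - \<rho> k\<bar> \<le> 1 / 4"
    using eventually_ratio_near_one by (auto simp: eventually_sequentially)
  then have "\<Delta>t (j + N) = \<Delta>t N * 2 ^ j" for j
    by (induction j) (auto simp: dt_doubles)
  moreover have "filterlim (\<lambda>j. \<Delta>t N * 2 ^ j) at_top sequentially"
    by (intro filterlim_tendsto_pos_mult_at_top[OF tendsto_const dt_pos]
        filterlim_at_infinity_imp_filterlim_at_top filterlim_realpow_sequentially_gt1) auto
  ultimately have "filterlim (\<lambda>j. \<Delta>t (j + N)) at_top sequentially"
    by simp
  then show ?thesis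
    unfolding filterlim_at_top eventually_sequentially_seg[of "\<lambda>j. Z \<le> \<Delta>t j" N for Z] .
qed

lemma \<alpha>_tendsto_1: "\<alpha> \<longlonglongrightarrow> 1"
proof -
  have "(\<lambda>k. inverse (\<Delta>t k)) \<longlonglongrightarrow> 0"
    by (rule tendsto_inverse_0_at_top[OF dt_at_top])
  then have "(\<lambda>k. 1 / (inverse (\<Delta>t k) + 1)) \<longlonglongrightarrow> 1 / (0 + 1)"
    by (intro tendsto_intros) auto
  moreover have "1 / (inverse (\<Delta>t k) + 1) = \<alpha> k" for k
    using dt_pos[of k] by (simp add: \<alpha>_def field_simps)
  ultimately show ?thesis by simp
qed

lemma \<mu>_tendsto_0: "(\<lambda>k. cnmtr_mu c\<^sub>\<epsilon> (\<Delta>t k)) \<longlonglongrightarrow> 0"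
proof -
  have "(\<lambda>k. inverse (\<Delta>t k)) \<longlonglongrightarrow> 0"
    by (rule tendsto_inverse_0_at_top[OF dt_at_top])
  moreover have "eventually (\<lambda>k. \<Delta>t k > 1 / c\<^sub>\<epsilon>) sequentially"
    using dt_at_top by (simp add: filterlim_at_top_dense)
  then have "eventually (\<lambda>k. inverse (\<Delta>t k) = cnmtr_mu c\<^sub>\<epsilon> (\<Delta>t k)) sequentially"
    by eventually_elim (simp add: cnmtr_mu_def inverse_eq_divide)
  ultimately show ?thesis
    by (rule Lim_transform_eventually)
qed

text \<open>
  The contraction factor of a step with a fresh prediction is that of the damped regularised model
  plus a multiple of \<open>\<parallel>F\<parallel>\<close> from the linearisation error; both contributions vanish in the limit.
  Since every late step is accepted, every late prediction is fresh, so its regularisation is the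
  one of the current, growing time step.
\<close>

lemma residual_superlinear:
  obtains \<epsilon> where "\<epsilon> \<longlonglongrightarrow> 0"
    "eventually (\<lambda>k. norm (F (x (Suc k))) \<le> \<epsilon> k * norm (F (x k))) sequentially"
proof
  define \<epsilon> where "\<epsilon> k = (1 - \<alpha> k * (\<nu> / (cnmtr_mu c\<^sub>\<epsilon> (\<Delta>t k) + \<nu>)))
    + L / \<nu>\<^sup>2 * (\<alpha> k)\<^sup>2 * norm (F (x k))" for k
  have "\<epsilon> \<longlonglongrightarrow> (1 - 1 * (\<nu> / (0 + \<nu>))) + L / \<nu>\<^sup>2 * 1\<^sup>2 * 0"
    unfolding \<epsilon>_def using \<nu>_pos
    by (intro tendsto_intros \<alpha>_tendsto_1 \<mu>_tendsto_0 residual_tendsto_0) auto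
  then show "\<epsilon> \<longlonglongrightarrow> 0"
    using \<nu>_pos by simp
  have acc: "eventually (\<lambda>k. \<rho> k \<ge> \<eta>\<^sub>a) sequentially"
    using eventually_ratio_near_one by eventually_elim (rule ratio_near_one_accepts)
  have "eventually (\<lambda>k. \<rho> (k - 1) \<ge> \<eta>\<^sub>a) sequentially"
    by (rule eventually_sequentially_Suc[THEN iffD1]) (use acc in simp)
  with acc show "eventually (\<lambda>k. norm (F (x (Suc k))) \<le> \<epsilon> k * norm (F (x k))) sequentially"
  proof eventually_elim
    case (elim k)
    have "norm (F (x (Suc k))) \<le> norm (F (x k) + J (x k) *v s k)
        + norm (F (x k + s k) - (F (x k) + J (x k) *v s k))"
      using norm_triangle_ineq[of "F (x k) + J (x k) *v s k" "F (x k + s k) - (F (x k) + J (x k) *v s k)"]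
      by (simp add: accepted[OF elim(1)])
    also have "\<dots> \<le> (1 - \<alpha> k * (\<nu> / (cnmtr_mu c\<^sub>\<epsilon> (\<Delta>t k) + \<nu>))) * norm (F (x k))
        + L * (\<alpha> k * norm (F (x k)) / \<nu>)\<^sup>2"
    proof (rule add_mono[OF _ model_error])
      show "norm (F (x k) + J (x k) *v s k)
          \<le> (1 - \<alpha> k * (\<nu> / (cnmtr_mu c\<^sub>\<epsilon> (\<Delta>t k) + \<nu>))) * norm (F (x k))"
        unfolding trial_step using \<alpha>_bounds[of k] elim(2)
        by (intro damped_model_bound cnmtr_mu_bounds dt_pos predicted_fresh) auto
    qed
    also have "\<dots> = \<epsilon> k * norm (F (x k))"
      by (simp add: \<epsilon>_def power2_eq_square algebra_simps)
    finally show ?case .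
  qed
qed

lemma converges_superlinearly_to_zero_in_hyperplane:
  assumes zero: "F z = 0" and plane: "c \<bullet> z = c \<bullet> x 0"
  shows "converges_superlinearly x z"
proof -
  have error_bound: "norm (x k - z) \<le> norm (F (x k)) / \<nu>" for k
    using residual_error_bound[of "x k" z] iterates_in_hyperplane[of k] zero plane \<nu>_pos
    by (simp add: inner_diff_right field_simps)
  have dist0: "(\<lambda>k. norm (x k - z)) \<longlonglongrightarrow> 0"
  proof (rule tendsto_sandwich[where f = \<open>\<lambda>_. 0\<close>])
    have "(\<lambda>k. norm (F (x k)) / \<nu>) \<longlonglongrightarrow> 0 / \<nu>"
      using \<nu>_pos by (intro tendsto_intros residual_tendsto_0) auto
    then show "(\<lambda>k. norm (F (x k)) / \<nu>) \<longlonglongrightarrow> 0" by simp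
  qed (use error_bound in auto)
  define M where "M = induced_norm (J z) + L"
  have M: "M \<ge> 0"
    using L_pos onorm_pos_le[OF matrix_vector_mul_bounded_linear, of "J z"]
    by (simp add: M_def induced_norm_def)
  obtain \<epsilon> where \<epsilon>: "\<epsilon> \<longlonglongrightarrow> 0"
    "eventually (\<lambda>k. norm (F (x (Suc k))) \<le> \<epsilon> k * norm (F (x k))) sequentially"
    by (rule residual_superlinear)
  have near: "eventually (\<lambda>k. norm (x k - z) < 1) sequentially"
    using order_tendstoD(2)[OF dist0] by simp
  have "(\<lambda>k. norm (x (Suc k) - z) / norm (x k - z)) \<longlonglongrightarrow> 0"
  proof (rule tendsto_sandwich[where f = \<open>\<lambda>_. 0\<close>])
    show "eventually (\<lambda>k. norm (x (Suc k) - z) / norm (x k - z) \<le> \<bar>\<epsilon> k\<bar> * M / \<nu>) sequentially"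
      using \<epsilon>(2) near
    proof eventually_elim
      case (elim k)
      have "norm (x (Suc k) - z) \<le> norm (F (x (Suc k))) / \<nu>"
        by (rule error_bound)
      also have "\<dots> \<le> \<bar>\<epsilon> k\<bar> * norm (F (x k)) / \<nu>"
        using elim(1) \<nu>_pos
        by (intro divide_right_mono order_trans[OF elim(1)] mult_right_mono) auto
      also have "\<dots> \<le> \<bar>\<epsilon> k\<bar> * (M * norm (x k - z)) / \<nu>"
        using elim(2) \<nu>_pos unfolding M_def
        by (intro divide_right_mono mult_left_mono residual_le_distance zero) auto
      finally have "norm (x (Suc k) - z) \<le> \<bar>\<epsilon> k\<bar> * M / \<nu> * norm (x k - z)"
        by simp
      moreover have "norm (x k - z) > 0"
        using residual_nonzero[of k] zero by auto
      ultimately show ?case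
        by (simp add: pos_divide_le_eq)
    qed
    have "(\<lambda>k. \<bar>\<epsilon> k\<bar> * M / \<nu>) \<longlonglongrightarrow> \<bar>0\<bar> * M / \<nu>"
      using \<nu>_pos by (intro tendsto_intros \<epsilon>(1)) auto
    then show "(\<lambda>k. \<bar>\<epsilon> k\<bar> * M / \<nu>) \<longlonglongrightarrow> 0" by simp
  qed auto
  then show ?thesis
    using dist0 by (simp add: converges_superlinearly_def tendsto_norm_zero_iff LIM_zero_iff)
qed

end

theorem theorem4:
  fixes F :: "real ^ 'n \<Rightarrow> real ^ 'n"
    and J :: "real ^ 'n \<Rightarrow> real ^ 'n ^ 'n"
    and x :: "nat \<Rightarrow> real ^ 'n"
    and xs :: "real ^ 'n"
    and c\<^sub>\<epsilon> L :: real
    and r :: "nat \<Rightarrow> nat"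
  assumes "continuously_differentiable_with_jacobian F J"
    and "L > 0"
    and "\<And>x y. induced_norm (J x - J y) \<le> L * norm (x - y)"
    and "one_sided_lipschitz F J"
    and "c\<^sub>\<epsilon> > 0"
    and "cnmtr_sequence F J c\<^sub>\<epsilon> x"
    and "\<And>k. F (x k) \<noteq> 0"
    and "strict_mono r"
    and "(\<lambda>i. x (r i)) \<longlonglongrightarrow> xs"
  shows "converges_superlinearly x xs"
proof -
  obtain c \<nu> where c: "\<And>x. c \<bullet> F x = 0" "\<nu> > 0"
      "\<And>x y. c \<bullet> y = 0 \<Longrightarrow> y \<bullet> (J x *v y) \<le> - \<nu> * (norm y)\<^sup>2"
    using \<open>one_sided_lipschitz F J\<close> unfolding one_sided_lipschitz_def by blast
  have deriv: "(F has_derivative (\<lambda>h. J y *v h)) (at y)" for y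
    using assms(1) by (simp add: continuously_differentiable_with_jacobian_def)
  obtain \<Delta>t sP s \<rho> where "cnmtr_run F J c\<^sub>\<epsilon> x \<Delta>t sP s \<rho>"
    using assms(6) by (auto simp: cnmtr_sequence_def)
  then interpret cnmtr_iteration F J c \<nu> L c\<^sub>\<epsilon> x \<Delta>t sP s \<rho>
    using assms deriv c by unfold_locales auto
  have "(\<lambda>i. F (x (r i))) \<longlonglongrightarrow> F xs"
    using assms(9) has_derivative_continuous[OF deriv] isCont_tendsto_compose by blast
  moreover have "(\<lambda>i. F (x (r i))) \<longlonglongrightarrow> 0"
    using LIMSEQ_subseq_LIMSEQ[OF residual_tendsto_0 \<open>strict_mono r\<close>]
    by (simp add: o_def tendsto_norm_zero_iff)
  ultimately have "F xs = 0"
    by (rule LIMSEQ_unique)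
  moreover have "(\<lambda>i. c \<bullet> x (r i)) \<longlonglongrightarrow> c \<bullet> xs"
    by (intro tendsto_intros assms(9))
  then have "c \<bullet> xs = c \<bullet> x 0"
    unfolding iterates_in_hyperplane[of "r _"] by (simp add: LIMSEQ_const_iff)
  ultimately show ?thesis
    by (rule converges_superlinearly_to_zero_in_hyperplane)
qed

end
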